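(* Let $n\ge1$, let $K=(\beta(\mathbb{Z}^n)\times\mathbb{I}^n)/h$ and let $\sigma:\mathbb{R}^n\times K\to K$ be the action $$\sigma\big(\vec{x},[(p,\vec{i})]_h\big)=\big[\big(h_{[\vec{x}]+N}(p),\ \vec{i}+\{\vec{x}\}-N\big)\big]_h,$$ where $[\vec{x}]\in\mathbb{Z}^n$ is the coordinatewise integer part of $\vec{x}$, $\{\vec{x}\}=\vec{x}-[\vec{x}]$, and $N\in\{0,1\}^n$ has $N_k=1$ iff $i_k+\{\vec{x}\}_k\ge1$. Then the universal ambit of the additive group $\mathbb{R}^n$ (with the Euclidean topology) is isomorphic to the ambit $\big(\mathbb{R}^n,K,\sigma;[(0,\mathbf{0})]_h\big)$.
   Context: $\mathbb{I}=[0,1]$; $\beta(\mathbb{Z}^n)$ is the Čech–Stone compactification of the discrete group $\mathbb{Z}^n$. For $N\in\mathbb{Z}^n$, $h_N$ is the continuous extension to $\beta(\mathbb{Z}^n)$ of the translation $\vec{z}\mapsto\vec{z}+N$. For $A\subseteq\{1,\dots,n\}$, $\mathbf{1}_A\in\{0,1\}^n$ is its indicator vector and $\psi_A(\vec i)$ is obtained from $\vec i\in\mathbb{I}^n$ by replacing, for $a\in A$, a coordinate $i_a=1$ by $0$ and a coordinate $i_a=0$ by $1$. The equivalence relation $h$ on $\beta(\mathbb{Z}^n)\times\mathbb{I}^n$ identifies $(p,\vec i)$ with $(h_{\mathbf{1}_A}(p),\psi_A(\vec i))$ whenever $A\subseteq\{j:i_j=1\}$; $[\cdot]_h$ denotes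 classes, and $[(0,\mathbf 0)]_h$ is the class of $(0\in\mathbb{Z}^n,\ \mathbf 0\in\mathbb{I}^n)$. An ambit $(G,X,\pi;x)$ is a continuous action $\pi$ of a topological group $G$ on a compact Hausdorff space $X$ with a point $x$ of dense orbit. A homomorphism of ambits $(G,X,\pi;x)\to(G,Y,\varrho;y)$ is a continuous $G$-equivariant map sending $x$ to $y$; an isomorphism is a homomorphism that is a homeomorphism. An ambit is universal for $G$ if it admits a surjective homomorphism of ambits onto every ambit of $G$; the universal ambit of $G$ is unique up to isomorphism (it can be realized as the Samuel compactification $S(G)$ of $G$ with respect to its right uniformity, with the extension of left translation and base point the identity). *)

theory Defs
  imports "HOL-Analysis.Analysis"
begin

section \<open>Ultrafilters and the Cech-Stone compactification of a discrete set\<close>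

text \<open>beta(D) for a discrete set D (here the whole type) is realised as the space of
ultrafilters on D with the Stone topology (basic open sets {p. A in p}).\<close>

definition is_ultrafilter :: "'a set set \<Rightarrow> bool" where
  "is_ultrafilter U \<longleftrightarrow>
     UNIV \<in> U \<and> {} \<notin> U \<and>
     (\<forall>A B. A \<in> U \<longrightarrow> B \<in> U \<longrightarrow> A \<inter> B \<in> U) \<and>
     (\<forall>A B. A \<in> U \<longrightarrow> A \<subseteq> B \<longrightarrow> B \<in> U) \<and>
     (\<forall>A. A \<in> U \<or> - A \<in> U)"

definition beta_space :: "'a set set set" where
  "beta_space = {U. is_ultrafilter U}"

definition beta_topology :: "'a set set topology" where
  "beta_topology = topology_generated_by {{p \<in> beta_space. A \<in> p} | A. True}"

text \<open>principal ultrafilter: the embedding of a point of D into beta(D)\<close>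
definition beta_point :: "'a \<Rightarrow> 'a set set" where
  "beta_point z = {A. z \<in> A}"

text \<open>continuous extension of a map D -> D to beta(D) (image ultrafilter)\<close>
definition beta_ext :: "('a \<Rightarrow> 'a) \<Rightarrow> 'a set set \<Rightarrow> 'a set set" where
  "beta_ext f p = {A. f -` A \<in> p}"

text \<open>h_N: extension of the translation z |-> z + N of Z^n\<close>
definition hN :: "int^'n \<Rightarrow> (int^'n) set set \<Rightarrow> (int^'n) set set" where
  "hN N = beta_ext (\<lambda>z. z + N)"

section \<open>Quotient topology\<close>

definition quotient_topology :: "'a topology \<Rightarrow> ('a \<times> 'a) set \<Rightarrow> 'a set topology" where
  "quotient_topology X E =
     topology (\<lambda>U. U \<subseteq> topspace X // E \<and> openin X (\<Union>U))"

section \<open>The space K = (beta(Z^n) x I^n)/h and the action K_sigma\<close>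

definition unit_cube :: "(real^'n) set" where
  "unit_cube = {i. \<forall>k. 0 \<le> i$k \<and> i$k \<le> 1}"

definition indic_vec :: "'n set \<Rightarrow> int^'n" where
  "indic_vec A = (\<chi> k. if k \<in> A then 1 else 0)"

definition psi :: "'n set \<Rightarrow> real^'n \<Rightarrow> real^'n" where
  "psi A i = (\<chi> k. if k \<in> A \<and> i$k = 1 then 0 else if k \<in> A \<and> i$k = 0 then 1 else i$k)"

definition BI_topology :: "((int^'n) set set \<times> (real^'n)) topology" where
  "BI_topology = prod_topology beta_topology (subtopology euclidean unit_cube)"

text \<open>generating relation of h\<close>
definition h_gen :: "(((int^'n) set set \<times> (real^'n)) \<times> ((int^'n) set set \<times> (real^'n))) set" where
  "h_gen = {((p, i), (hN (indic_vec A) p, psi A i)) | p i A.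
              p \<in> beta_space \<and> i \<in> unit_cube \<and> A \<subseteq> {j. i$j = 1}}"

text \<open>h: the equivalence relation on beta(Z^n) x I^n generated by h_gen\<close>
definition h_rel :: "(((int^'n) set set \<times> (real^'n)) \<times> ((int^'n) set set \<times> (real^'n))) set" where
  "h_rel = Restr ((h_gen \<union> h_gen\<inverse>)\<^sup>*) (beta_space \<times> unit_cube)"

definition K_topology :: "((int^'n) set set \<times> (real^'n)) set topology" where
  "K_topology = quotient_topology BI_topology h_rel"

definition h_class :: "(int^'n) set set \<times> (real^'n) \<Rightarrow> ((int^'n) set set \<times> (real^'n)) set" where
  "h_class x = h_rel `` {x}"

definition floor_vec :: "real^'n \<Rightarrow> int^'n" where
  "floor_vec x = (\<chi> k. \<lfloor>x$k\<rfloor>)"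

definition frac_vec :: "real^'n \<Rightarrow> real^'n" where
  "frac_vec x = (\<chi> k. x$k - of_int \<lfloor>x$k\<rfloor>)"

definition carry_vec :: "real^'n \<Rightarrow> real^'n \<Rightarrow> int^'n" where
  "carry_vec x i = (\<chi> k. if i$k + frac_vec x $ k \<ge> 1 then 1 else 0)"

text \<open>K_sigma on representatives\<close>
definition sigma_rep :: "real^'n \<Rightarrow> (int^'n) set set \<times> (real^'n) \<Rightarrow> (int^'n) set set \<times> (real^'n)" where
  "sigma_rep x rp = (case rp of (p, i) \<Rightarrow>
     (hN (floor_vec x + carry_vec x i) p,
      i + frac_vec x - (\<chi> k. of_int (carry_vec x i $ k))))"

text \<open>K_sigma on classes, computed from a representative of the class\<close>
definition K_sigma :: "real^'n \<Rightarrow> ((int^'n) set set \<times> (real^'n)) set \<Rightarrow> ((int^'n) set set \<times> (real^'n)) set" where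
  "K_sigma x c = h_class (sigma_rep x (SOME rp. rp \<in> c))"

definition K_base :: "((int^'n) set set \<times> (real^'n)) set" where
  "K_base = h_class (beta_point 0, 0)"

section \<open>Ambits of a topological group (additive group on a topological type)\<close>

definition ambit :: "'x topology \<Rightarrow> ('g::{topological_space,group_add} \<Rightarrow> 'x \<Rightarrow> 'x) \<Rightarrow> 'x \<Rightarrow> bool" where
  "ambit X \<pi> x0 \<longleftrightarrow>
     compact_space X \<and> Hausdorff_space X \<and>
     continuous_map (prod_topology (euclidean :: 'g topology) X) X (\<lambda>(g, x). \<pi> g x) \<and>
     (\<forall>x \<in> topspace X. \<pi> 0 x = x) \<and>
     (\<forall>g h x. x \<in> topspace X \<longrightarrow> \<pi> (g + h) x = \<pi> g (\<pi> h x)) \<and>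
     x0 \<in> topspace X \<and>
     X closure_of (range (\<lambda>g. \<pi> g x0)) = topspace X"

definition ambit_hom ::
  "'x topology \<Rightarrow> ('g::{topological_space,group_add} \<Rightarrow> 'x \<Rightarrow> 'x) \<Rightarrow> 'x \<Rightarrow>
   'y topology \<Rightarrow> ('g \<Rightarrow> 'y \<Rightarrow> 'y) \<Rightarrow> 'y \<Rightarrow> ('x \<Rightarrow> 'y) \<Rightarrow> bool" where
  "ambit_hom X \<pi> x0 Y \<rho> y0 f \<longleftrightarrow>
     continuous_map X Y f \<and>
     (\<forall>g. \<forall>x \<in> topspace X. f (\<pi> g x) = \<rho> g (f x)) \<and>
     f x0 = y0"

end

theory Submission
  imports Defs
begin

text \<open>Think of the class of \<open>(p, i)\<close> as the point \<open>p + i\<close>: the relation \<open>h\<close> identifies exactly the pairs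
with the same carried form \<open>(h\<^bsub>[i]\<^esub>(p), {i})\<close>, and the action is \<open>\<sigma>(x, p + i) = p + (i + x)\<close>.
Given an ambit \<open>(Y, \<rho>, y0)\<close>, the map \<open>z \<mapsto> \<rho> z y0\<close> on \<open>\<int>\<^sup>n\<close> extends continuously to
\<open>F : \<beta>(\<int>\<^sup>n) \<rightarrow> Y\<close>. By density \<open>F \<circ> h\<^bsub>N\<^esub> = \<rho> N \<circ> F\<close>, so \<open>p + i \<mapsto> \<rho> i (F p)\<close> is well defined;
it is the required homomorphism, and it is onto because its image is compact and contains
a dense orbit.\<close>

section \<open>The space of ultrafilters\<close>

lemma is_ultrafilterD:
  assumes "is_ultrafilter p"
  shows "UNIV \<in> p" "{} \<notin> p" "A \<in> p \<Longrightarrow> B \<in> p \<Longrightarrow> A \<inter> B \<in> p" "A \<in> p \<Longrightarrow> A \<subseteq> B \<Longrightarrow> B \<in> p"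
    "- A \<in> p \<longleftrightarrow> A \<notin> p"
proof -
  have p: "UNIV \<in> p" "{} \<notin> p" "\<forall>A B. A \<in> p \<longrightarrow> B \<in> p \<longrightarrow> A \<inter> B \<in> p"
     "\<forall>A B. A \<in> p \<longrightarrow> A \<subseteq> B \<longrightarrow> B \<in> p" "\<forall>A. A \<in> p \<or> - A \<in> p"
    using assms unfolding is_ultrafilter_def by simp_all
  show "UNIV \<in> p" "{} \<notin> p" by (fact p)+
  show 1: "A \<inter> B \<in> p" if "A \<in> p" "B \<in> p" for A B
    using p(3) that by simp
  show "B \<in> p" if "A \<in> p" "A \<subseteq> B"
    using p(4) that by metis
  have "\<not> (A \<in> p \<and> - A \<in> p)"
    using 1[of A "- A"] p(2) by auto
  then show "- A \<in> p \<longleftrightarrow> A \<notin> p"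
    using p(5) by metis
qed

text \<open>If \<open>A\<close> is not in \<open>p\<close>, its complement is, and intersecting with
  that complement removes \<open>A\<close> from the union. This drives the finite-subcover argument
  for limits along an ultrafilter.\<close>

lemma ultrafilter_finite_Union:
  assumes p: "is_ultrafilter p" and "finite \<F>" "\<Union>\<F> \<in> p"
  shows "\<exists>A\<in>\<F>. A \<in> p"
  using assms(2,3)
proof (induction \<F> rule: finite_induct)
  case empty
  then show ?case using is_ultrafilterD(2)[OF p] by simp
next
  case (insert A \<F>)
  show ?case
  proof (cases "A \<in> p")
    case False
    then have "- A \<inter> \<Union>(insert A \<F>) \<in> p"
      using insert.prems is_ultrafilterD(3,5)[OF p] by simp
    then have "\<Union>\<F> \<in> p"
      by (rule is_ultrafilterD(4)[OF p]) auto
    then show ?thesis using insert.IH by simp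
  qed simp
qed

lemma Union_beta_basic: "\<Union>{{p \<in> beta_space. A \<in> p} |A. True} = beta_space"
proof
  have "beta_space \<subseteq> {p \<in> beta_space. UNIV \<in> p}"
    by (simp add: beta_space_def is_ultrafilterD(1) Collect_mono)
  then show "beta_space \<subseteq> \<Union>{{p \<in> beta_space. A \<in> p} |A. True}"
    by blast
qed blast

lemma topspace_beta [simp]: "topspace beta_topology = beta_space"
  by (simp only: beta_topology_def topology_generated_by_topspace Union_beta_basic)

lemma openin_beta_basic: "openin beta_topology {p \<in> beta_space. A \<in> p}"
  unfolding beta_topology_def by (rule topology_generated_by_Basis) blast

text \<open>The generating sets of \<open>A\<close> and \<open>B\<close> meet in the generating set
  of \<open>A \<inter> B\<close>, so they form a base and not only a subbase.\<close>

lemma beta_basis: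
  assumes "openin beta_topology U" "p \<in> U"
  obtains A where "A \<in> p" "{q \<in> beta_space. A \<in> q} \<subseteq> U"
proof -
  have "generate_topology_on {{p \<in> beta_space. A \<in> p} | A. True} U"
    using assms(1) unfolding beta_topology_def by (rule openin_topology_generated_by)
  then have "p \<in> beta_space \<Longrightarrow> p \<in> U \<Longrightarrow> \<exists>A. A \<in> p \<and> {q \<in> beta_space. A \<in> q} \<subseteq> U"
  proof (induction rule: generate_topology_on.induct)
    case (Int U V)
    then obtain A B where AB: "A \<in> p" "{q \<in> beta_space. A \<in> q} \<subseteq> U"
        "B \<in> p" "{q \<in> beta_space. B \<in> q} \<subseteq> V" by blast
    have "A \<inter> B \<in> p"
      using AB Int.prems(1) by (simp add: beta_space_def is_ultrafilterD(3))
    moreover have "{q \<in> beta_space. A \<inter> B \<in> q} \<subseteq> U \<inter> V"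
      using AB(2,4) is_ultrafilterD(4) unfolding beta_space_def by blast
    ultimately show ?case by blast
  next
    case (UN K)
    then obtain k where "k \<in> K" "p \<in> k" by blast
    with UN obtain A where "A \<in> p" "{q \<in> beta_space. A \<in> q} \<subseteq> k" by blast
    with \<open>k \<in> K\<close> show ?case by blast
  qed auto
  then show thesis
    using that assms openin_subset[OF assms(1)] by auto
qed

section \<open>Principal ultrafilters and extended maps\<close>

lemma is_ultrafilter_beta_point: "is_ultrafilter (beta_point z)"
  by (auto simp: is_ultrafilter_def beta_point_def)

lemma beta_point_in_beta_space [simp]: "beta_point z \<in> beta_space"
  by (simp add: beta_space_def is_ultrafilter_beta_point)

lemma is_ultrafilter_beta_ext:
  assumes p: "is_ultrafilter p"
  shows "is_ultrafilter (beta_ext f p)"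
  unfolding is_ultrafilter_def beta_ext_def mem_Collect_eq
proof (intro conjI allI impI)
  show "f -` B \<in> p" if "f -` A \<in> p" "A \<subseteq> B" for A B
    using is_ultrafilterD(4)[OF p that(1)] that(2) by blast
qed (simp_all add: is_ultrafilterD(1-3)[OF p] is_ultrafilterD(5)[OF p] vimage_Compl)

lemma beta_ext_in_beta_space: "p \<in> beta_space \<Longrightarrow> beta_ext f p \<in> beta_space"
  by (simp add: beta_space_def is_ultrafilter_beta_ext)

lemma beta_ext_beta_point: "beta_ext f (beta_point z) = beta_point (f z)"
  by (auto simp: beta_ext_def beta_point_def)

lemma beta_ext_beta_ext: "beta_ext f (beta_ext g p) = beta_ext (f \<circ> g) p"
  by (simp add: beta_ext_def vimage_comp)

lemma continuous_map_beta_ext: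
  fixes f :: "'a \<Rightarrow> 'a"
  shows "continuous_map beta_topology beta_topology (beta_ext f)"
\<comment> \<open>Only the codomain is unfolded, so preimages need testing on generators alone; the
  preimage of the generator of \<open>A\<close> is the generator of the preimage of \<open>A\<close>
  under \<open>f\<close>.\<close>
proof (subst (2) beta_topology_def, rule continuous_on_generated_topo)
  fix U :: "'a set set set" assume "U \<in> {{p \<in> beta_space. A \<in> p} |A. True}"
  then obtain A where U: "U = {p \<in> beta_space. A \<in> p}" by blast
  have "beta_ext f -` U \<inter> topspace beta_topology = {p \<in> beta_space. f -` A \<in> p}"
    by (auto simp: U beta_ext_in_beta_space) (auto simp: beta_ext_def)
  then show "openin beta_topology (beta_ext f -` U \<inter> topspace beta_topology)"
    by (simp add: openin_beta_basic)
next
  show "beta_ext f ` topspace beta_topology \<subseteq> \<Union> {{p \<in> beta_space. A \<in> p} |A. True}"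
    unfolding Union_beta_basic by (auto simp: beta_ext_in_beta_space)
qed

text \<open>Members of an ultrafilter are nonempty, so the basic open set of \<open>A\<close>
  contains the principal ultrafilter of any point of \<open>A\<close>.\<close>

lemma beta_point_dense: "beta_topology closure_of range beta_point = beta_space"
proof -
  have "\<exists>y\<in>range beta_point. y \<in> T" if T: "openin beta_topology T" "p \<in> T" for p :: "'a set set" and T
  proof -
    obtain A where A: "A \<in> p" "{q \<in> beta_space. A \<in> q} \<subseteq> T"
      using beta_basis[OF T] .
    have "is_ultrafilter p"
      using T openin_subset by (fastforce simp: beta_space_def)
    then obtain z where "z \<in> A"
      using A(1) is_ultrafilterD(2) by (metis ex_in_conv)
    then have "beta_point z \<in> T"
      using A(2) beta_point_in_beta_space[of z] by (auto simp: beta_point_def simp del: beta_point_in_beta_space)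
    then show ?thesis by blast
  qed
  then show ?thesis
    by (auto simp: closure_of_def)
qed

lemma Hausdorff_space_beta: "Hausdorff_space beta_topology"
  unfolding Hausdorff_space_def topspace_beta
proof (intro allI impI, elim conjE)
  fix p q :: "'a set set" assume pq: "p \<in> beta_space" "q \<in> beta_space" "p \<noteq> q"
  \<comment> \<open>Passing to complements shows that an inclusion between ultrafilters is an
    equality. The generators of \<open>A\<close> and \<open>- A\<close> then separate
    \<open>p\<close> from \<open>q\<close>.\<close>
  have "\<exists>A. A \<in> p \<and> A \<notin> q"
  proof (rule ccontr)
    assume "\<nexists>A. A \<in> p \<and> A \<notin> q"
    then have "p \<subseteq> q" by blast
    moreover have "q \<subseteq> p"
      using \<open>p \<subseteq> q\<close> pq is_ultrafilterD(5) unfolding beta_space_def by blast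
    ultimately show False using pq by blast
  qed
  then obtain A where "A \<in> p" "A \<notin> q" by blast
  have "disjnt {p \<in> beta_space. A \<in> p} {p \<in> beta_space. - A \<in> p}" "- A \<in> q"
    using \<open>A \<notin> q\<close> pq by (auto simp: disjnt_iff beta_space_def is_ultrafilterD(5))
  then show "\<exists>U V. openin beta_topology U \<and> openin beta_topology V \<and> p \<in> U \<and> q \<in> V \<and> disjnt U V"
    using openin_beta_basic[of A] openin_beta_basic[of "- A"] pq \<open>A \<in> p\<close>
    by (metis (mono_tags, lifting) mem_Collect_eq)
qed

text \<open>Ultrafilters form a closed subset of the Cantor cube of all set families, so Tychonoff's
theorem applies.\<close>

lemma compact_space_beta: "compact_space (beta_topology :: 'a set set topology)"
proof -
  define T :: "('a set \<Rightarrow> bool) topology" where "T = product_topology (\<lambda>_. discrete_topology UNIV) UNIV"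
  have T [simp]: "topspace T = UNIV"
    by (simp add: T_def)
  have proj: "continuous_map T (discrete_topology UNIV) (\<lambda>f. f A)" for A
    unfolding T_def by (rule continuous_map_product_projection) simp
  \<comment> \<open>Each coordinate is discrete, so a condition on one coordinate and its negation
    are both closed. The closure rules that follow assemble the ultrafilter axioms from such
    conditions.\<close>
  have clo: "closedin T {f. f A}" and nclo: "closedin T {f. \<not> f A}" for A
    using closedin_continuous_map_preimage[OF proj, of "{True}" A]
      closedin_continuous_map_preimage[OF proj, of "{False}" A] by simp_all
  have clo_imp: "closedin T {f. f A \<longrightarrow> P f}" if "closedin T {f. P f}" for A P
  proof -
    have "{f. f A \<longrightarrow> P f} = {f. \<not> f A} \<union> {f. P f}" by blast
    then show ?thesis using that nclo by auto
  qed
  have clo_all: "closedin T {f. \<forall>a. P f a}" if "\<And>a. closedin T {f. P f a}" for P :: "_ \<Rightarrow> 'a set \<Rightarrow> bool"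
  proof -
    have "{f. \<forall>a. P f a} = (\<Inter>a. {f. P f a})" by blast
    then show ?thesis using that by auto
  qed
  have clo_conj: "closedin T {f. P f \<and> Q f}" if "closedin T {f. P f}" "closedin T {f. Q f}" for P Q
    using closedin_Int[OF that] by (simp add: Collect_conj_eq)
  have clo_disj: "closedin T {f. P f \<or> Q f}" if "closedin T {f. P f}" "closedin T {f. Q f}" for P Q
    using closedin_Un[OF that] by (simp add: Collect_disj_eq)
  define S :: "('a set \<Rightarrow> bool) set" where "S = {f. is_ultrafilter {A. f A}}"
  \<comment> \<open>In the upward-closure axiom the premise \<open>A \<subseteq> B\<close> does not
    depend on \<open>f\<close>; the constant \<open>c\<close> stands for it.\<close>
  have imp_const: "closedin T {f. f A \<longrightarrow> c \<longrightarrow> f B}" for A B c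
    using clo_imp[OF clo] by (cases c) (simp_all add: closedin_topspace[of T, simplified])
  have "closedin T S"
    unfolding S_def is_ultrafilter_def mem_Collect_eq
    by (intro clo_conj clo_all clo_imp clo_disj clo nclo imp_const)
  moreover have "compact_space T"
    unfolding T_def by (simp add: compact_space_product_topology compact_space_discrete_topology)
  ultimately have "compactin T S"
    using closedin_compact_space by blast
  then have "compactin (subtopology T S) S"
    by (simp add: compactin_subtopology)
  \<comment> \<open>\<open>Collect\<close> turns a predicate on sets into the family it describes,
    and preimages of generators are open cylinders.\<close>
  moreover have "continuous_map (subtopology T S) beta_topology Collect"
  proof (subst beta_topology_def, rule continuous_on_generated_topo)
    fix U :: "'a set set set" assume "U \<in> {{p \<in> beta_space. A \<in> p} |A. True}"
    then obtain A where U: "U = {p \<in> beta_space. A \<in> p}" by blast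
    have "Collect -` U \<inter> topspace (subtopology T S) = {f. f A} \<inter> S"
      by (auto simp: U S_def beta_space_def)
    moreover have "openin T {f. f A}"
      using openin_continuous_map_preimage[OF proj, of "{True}" A] by simp
    ultimately show "openin (subtopology T S) (Collect -` U \<inter> topspace (subtopology T S))"
      by (auto simp: openin_subtopology)
  next
    show "Collect ` topspace (subtopology T S) \<subseteq> \<Union> {{p \<in> beta_space. A \<in> p} |A. True}"
      unfolding Union_beta_basic by (auto simp: S_def beta_space_def)
  qed
  ultimately have "compactin beta_topology (Collect ` S)"
    by (rule image_compactin)
  moreover have "Collect ` S = beta_space"
  proof -
    have "p \<in> Collect ` S" if "is_ultrafilter p" for p
      using that by (intro image_eqI[of _ _ "\<lambda>A. A \<in> p"]) (auto simp: S_def)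
    then show ?thesis by (auto simp: S_def beta_space_def)
  qed
  ultimately show ?thesis
    by (simp add: compact_space_def)
qed

text \<open>\<open>F p\<close> is the limit of \<open>g\<close> along \<open>p\<close>: compactness
  of \<open>Y\<close> gives existence, the Hausdorff property uniqueness, and regularity continuity
  in \<open>p\<close>.\<close>

lemma beta_extension_exists:
  fixes g :: "'a \<Rightarrow> 'y"
  assumes Y: "compact_space Y" "Hausdorff_space Y" and g: "range g \<subseteq> topspace Y"
  obtains F where "continuous_map beta_topology Y F" "\<And>z. F (beta_point z) = g z"
proof -
  define L where "L p y \<longleftrightarrow> y \<in> topspace Y \<and> (\<forall>U. openin Y U \<longrightarrow> y \<in> U \<longrightarrow> g -` U \<in> p)" for p y
  have ex: "\<exists>y. L p y" if p: "is_ultrafilter p" for p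
  proof (rule ccontr)
    assume "\<nexists>y. L p y"
    then have "\<forall>y\<in>topspace Y. \<exists>U. openin Y U \<and> y \<in> U \<and> g -` U \<notin> p"
      unfolding L_def by blast
    \<comment> \<open>Without a limit, open sets whose preimages lie outside \<open>p\<close> cover
      \<open>Y\<close>; a finite subcover would force one of these preimages into
      \<open>p\<close>.\<close>
    then have "topspace Y \<subseteq> \<Union>{U. openin Y U \<and> g -` U \<notin> p}"
      by blast
    then obtain \<F> where \<F>: "finite \<F>" "\<F> \<subseteq> {U. openin Y U \<and> g -` U \<notin> p}" "topspace Y \<subseteq> \<Union>\<F>"
      using compactinD[of Y "topspace Y" "{U. openin Y U \<and> g -` U \<notin> p}"] Y(1)
      unfolding compact_space_def by blast
    have "\<Union>((\<lambda>U. g -` U) ` \<F>) = UNIV"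
      using \<F>(3) g by blast
    then have "\<Union>((\<lambda>U. g -` U) ` \<F>) \<in> p"
      using is_ultrafilterD(1)[OF p] by simp
    then obtain A where "A \<in> (\<lambda>U. g -` U) ` \<F>" "A \<in> p"
      using ultrafilter_finite_Union[OF p] \<F>(1) by (metis finite_imageI)
    then show False using \<F>(2) by blast
  qed
  define F where "F p = (SOME y. L p y)" for p
  have F: "L p (F p)" if "p \<in> beta_space" for p
    unfolding F_def by (rule someI_ex[OF ex]) (use that in \<open>simp add: beta_space_def\<close>)
  have uniq: "x = y" if p: "is_ultrafilter p" and xy: "L p x" "L p y" for p x y
  proof (rule ccontr)
    assume "x \<noteq> y"
    then obtain U V where "openin Y U" "openin Y V" "x \<in> U" "y \<in> V" "disjnt U V"
      using Y(2) xy unfolding Hausdorff_space_def L_def by metis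
    then have "g -` U \<inter> g -` V \<in> p" "g -` U \<inter> g -` V = {}"
      using xy is_ultrafilterD(3)[OF p] unfolding L_def disjnt_def by auto
    then show False using is_ultrafilterD(2)[OF p] by simp
  qed
  have "continuous_map beta_topology Y F"
  proof (clarsimp simp: continuous_map_def, intro conjI allI impI)
    show "F \<in> beta_space \<rightarrow> topspace Y"
      using F by (auto simp: L_def)
    fix U assume U: "openin Y U"
    show "openin beta_topology {p \<in> beta_space. F p \<in> U}"
    proof (subst openin_subopen, clarify)
      fix p assume p: "p \<in> beta_space" "F p \<in> U"
      \<comment> \<open>Regularity puts a closed \<open>C\<close> between \<open>V\<close> and
        \<open>U\<close>; limits along ultrafilters that contain the preimage of \<open>V\<close>
        cannot leave \<open>C\<close>.\<close>
      have "neighbourhood_base_of (closedin Y) Y"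
        using Y by (simp add: neighbourhood_base_of_closedin compact_Hausdorff_imp_regular_space)
      then obtain V C where VC: "openin Y V" "closedin Y C" "F p \<in> V" "V \<subseteq> C" "C \<subseteq> U"
        using U p(2) unfolding neighbourhood_base_of by meson
      have "F q \<in> U" if q: "q \<in> beta_space" "g -` V \<in> q" for q
      proof (rule ccontr)
        assume "F q \<notin> U"
        then have "F q \<in> topspace Y - C" "openin Y (topspace Y - C)"
          using VC F[OF q(1)] by (auto simp: L_def)
        then have "g -` (topspace Y - C) \<in> q"
          using F[OF q(1)] unfolding L_def by blast
        then have "g -` V \<inter> g -` (topspace Y - C) \<in> q"
          using q by (simp add: beta_space_def is_ultrafilterD(3))
        moreover have "g -` V \<inter> g -` (topspace Y - C) = {}"
          using VC by blast
        ultimately show False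
          using q by (simp add: beta_space_def is_ultrafilterD(2))
      qed
      moreover have "g -` V \<in> p"
        using F[OF p(1)] VC unfolding L_def by blast
      ultimately show "\<exists>T. openin beta_topology T \<and> p \<in> T \<and> T \<subseteq> {p \<in> beta_space. F p \<in> U}"
        using p by (intro exI[of _ "{q \<in> beta_space. g -` V \<in> q}"]) (auto simp: openin_beta_basic)
    qed
  qed
  moreover have "F (beta_point z) = g z" for z
    by (rule uniq[OF is_ultrafilter_beta_point[of z] F[OF beta_point_in_beta_space[of z]]])
      (use g in \<open>auto simp: L_def beta_point_def\<close>)
  ultimately show thesis using that by blast
qed

section \<open>Quotient topologies\<close>

text \<open>The constructor \<open>topology\<close> yields the intended open sets only once its
  predicate is known to satisfy \<open>istopology\<close>.\<close>

lemma openin_quotient_topology: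
  assumes E: "equiv (topspace X) E"
  shows "openin (quotient_topology X E) U \<longleftrightarrow> U \<subseteq> topspace X // E \<and> openin X (\<Union>U)"
proof -
  have "istopology (\<lambda>U. U \<subseteq> topspace X // E \<and> openin X (\<Union>U))"
    unfolding istopology_def
  proof (intro conjI allI impI; (elim conjE)?)
    fix S T assume ST: "S \<subseteq> topspace X // E" "T \<subseteq> topspace X // E" "openin X (\<Union>S)" "openin X (\<Union>T)"
    \<comment> \<open>This needs distinct classes to be disjoint.\<close>
    have "\<Union>(S \<inter> T) = \<Union>S \<inter> \<Union>T"
    proof
      show "\<Union>S \<inter> \<Union>T \<subseteq> \<Union>(S \<inter> T)"
      proof
        fix x assume "x \<in> \<Union>S \<inter> \<Union>T"
        then obtain s t where st: "x \<in> s" "s \<in> S" "x \<in> t" "t \<in> T" by blast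
        then have "s = t"
          using quotient_disj[OF E, of s t] ST by blast
        then show "x \<in> \<Union>(S \<inter> T)" using st by blast
      qed
    qed blast
    then show "openin X (\<Union>(S \<inter> T))" using openin_Int[OF ST(3,4)] by simp
    show "S \<inter> T \<subseteq> topspace X // E" using ST by blast
  next
    fix \<K> assume K: "\<forall>K\<in>\<K>. K \<subseteq> topspace X // E \<and> openin X (\<Union>K)"
    then show "\<Union>\<K> \<subseteq> topspace X // E" by blast
    have "\<Union>(\<Union>\<K>) = \<Union>(Union ` \<K>)" by blast
    then show "openin X (\<Union>(\<Union>\<K>))" using K by auto
  qed
  then show ?thesis
    by (simp add: quotient_topology_def topology_inverse')
qed

lemma topspace_quotient_topology:
  assumes E: "equiv (topspace X) E"
  shows "topspace (quotient_topology X E) = topspace X // E"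
proof -
  have "openin (quotient_topology X E) (topspace X // E)"
    by (simp add: openin_quotient_topology[OF E] Union_quotient[OF E])
  then show ?thesis
    using openin_quotient_topology[OF E] openin_subset openin_topspace by blast
qed

text \<open>The union of a set of classes is the preimage of that set under the class map.\<close>

lemma quotient_map_quotient_topology:
  assumes E: "equiv (topspace X) E"
  shows "quotient_map X (quotient_topology X E) (\<lambda>x. E `` {x})"
  unfolding quotient_map_def
proof (intro conjI allI impI)
  show "(\<lambda>x. E `` {x}) ` topspace X = topspace (quotient_topology X E)"
    by (auto simp: topspace_quotient_topology[OF E] quotient_def)
  fix U assume "U \<subseteq> topspace (quotient_topology X E)"
  then have U: "U \<subseteq> topspace X // E"
    by (simp add: topspace_quotient_topology[OF E])
  have "{x \<in> topspace X. E `` {x} \<in> U} = \<Union>U"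
  proof (intro set_eqI iffI)
    fix x assume "x \<in> {x \<in> topspace X. E `` {x} \<in> U}"
    then show "x \<in> \<Union>U"
      using equiv_class_self[OF E] by blast
  next
    fix x assume "x \<in> \<Union>U"
    then obtain u where u: "u \<in> U" "x \<in> u" by blast
    then obtain y where y: "y \<in> topspace X" "u = E `` {y}"
      using U by (blast elim: quotientE)
    then have "(y, x) \<in> E" using u by blast
    then have "E `` {y} = E `` {x}" "x \<in> topspace X"
      using equiv_class_eq[OF E] E by (auto simp: equiv_def refl_on_def)
    then show "x \<in> {x \<in> topspace X. E `` {x} \<in> U}"
      using u y by simp
  qed
  then show "openin X {x \<in> topspace X. E `` {x} \<in> U} = openin (quotient_topology X E) U"
    using U by (simp add: openin_quotient_topology[OF E])
qed

section \<open>The identification \<open>h\<close>\<close>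

definition real_vec :: "int^'n \<Rightarrow> real^'n" where
  "real_vec N = (\<chi> k. of_int (N $ k))"

lemma real_vec_nth [simp]: "real_vec N $ k = of_int (N $ k)"
  by (simp add: real_vec_def)

lemma real_vec_add: "real_vec (M + N) = real_vec M + real_vec N"
  by (simp add: vec_eq_iff)

lemma floor_vec_nth [simp]: "floor_vec x $ k = \<lfloor>x $ k\<rfloor>"
  by (simp add: floor_vec_def)

lemma frac_vec_eq: "frac_vec x = x - real_vec (floor_vec x)"
  by (simp add: frac_vec_def vec_eq_iff)

lemma floor_vec_diff_real_vec: "floor_vec (x - real_vec N) = floor_vec x - N"
  by (simp add: vec_eq_iff)

lemma hN_add: "hN M (hN N p) = hN (M + N) p"
  unfolding hN_def beta_ext_beta_ext by (simp add: comp_def add.commute add.left_commute add.assoc)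

lemma hN_zero [simp]: "hN 0 p = p"
  by (simp add: hN_def beta_ext_def)

lemma hN_in_beta_space [simp]: "p \<in> beta_space \<Longrightarrow> hN N p \<in> beta_space"
  by (simp add: hN_def beta_ext_in_beta_space)

lemma hN_beta_point: "hN N (beta_point z) = beta_point (z + N)"
  by (simp add: hN_def beta_ext_beta_point)

lemma continuous_map_hN: "continuous_map beta_topology beta_topology (hN N)"
  unfolding hN_def by (rule continuous_map_beta_ext)

text \<open>Canonical representative of the point \<open>p + i\<close>, with the integer part of
  \<open>i\<close> absorbed into \<open>p\<close>. It accepts any real vector, so that it also
  applies to sums that have left the cube.\<close>

definition carry_form :: "(int^'n) set set \<times> (real^'n) \<Rightarrow> (int^'n) set set \<times> (real^'n)" where
  "carry_form x = (hN (floor_vec (snd x)) (fst x), frac_vec (snd x))"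

text \<open>Moving the integer vector \<open>N\<close> from \<open>y\<close> into \<open>p\<close>
  lowers the floor by \<open>N\<close>, which the composition law of the \<open>hN\<close>
  compensates.\<close>

lemma carry_form_shift: "carry_form (hN N p, y - real_vec N) = carry_form (p, y)"
  by (simp add: carry_form_def frac_vec_eq floor_vec_diff_real_vec hN_add)
    (simp add: vec_eq_iff)

lemma frac_vec_in_unit_cube [simp]: "frac_vec y \<in> unit_cube"
proof -
  have "0 \<le> y $ k - \<lfloor>y $ k\<rfloor> \<and> y $ k - \<lfloor>y $ k\<rfloor> \<le> 1" for k
    by linarith
  then show ?thesis by (simp add: unit_cube_def frac_vec_def)
qed

lemma carry_form_in [simp]: "p \<in> beta_space \<Longrightarrow> carry_form (p, y) \<in> beta_space \<times> unit_cube"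
  by (simp add: carry_form_def)

lemma carry_form_idem: "carry_form (carry_form x) = carry_form x"
proof -
  obtain p y where x: "x = (p, y)" by (cases x)
  have "carry_form x = (hN (floor_vec y) p, y - real_vec (floor_vec y))"
    by (simp add: carry_form_def frac_vec_eq x)
  then show ?thesis
    by (metis carry_form_shift x)
qed

text \<open>Carrying first only shifts by an integer vector, and that shift survives adding
  \<open>y\<close>. Both the well-definedness of the action on classes and its additivity rest on
  this.\<close>

lemma carry_form_add:
  "carry_form (fst (carry_form x), snd (carry_form x) + y) = carry_form (fst x, snd x + y)"
  using carry_form_shift[of "floor_vec (snd x)" "fst x" "snd x + y"]
  by (simp add: carry_form_def[of x] frac_vec_eq algebra_simps)

text \<open>On such \<open>A\<close> the branch of \<open>psi\<close> that turns 0 into 1 never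
  applies. Hence every generating pair of \<open>h\<close> is an integer shift.\<close>

lemma psi_eq: "A \<subseteq> {j. i $ j = 1} \<Longrightarrow> psi A i = i - real_vec (indic_vec A)"
  by (auto simp: vec_eq_iff psi_def indic_vec_def)

lemma floor_vec_unit_cube:
  assumes "i \<in> unit_cube"
  shows "floor_vec i = indic_vec {j. i $ j = 1}"
proof (subst vec_eq_iff, intro allI)
  fix k
  have "0 \<le> i $ k" "i $ k \<le> 1"
    using assms by (simp_all add: unit_cube_def)
  then show "floor_vec i $ k = indic_vec {j. i $ j = 1} $ k"
    by (simp add: indic_vec_def) linarith
qed

text \<open>Since a cube coordinate is at most 1 and a fractional part is below 1, the carry is
  exactly the floor of their sum.\<close>

lemma sigma_rep_eq:
  assumes "i \<in> unit_cube"
  shows "sigma_rep x (p, i) = carry_form (p, i + x)"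
proof -
  have "floor_vec x + carry_vec x i = floor_vec (i + x)"
  proof (subst vec_eq_iff, intro allI)
    fix k
    have "0 \<le> i $ k" "i $ k \<le> 1"
      using assms by (auto simp: unit_cube_def)
    then show "(floor_vec x + carry_vec x i) $ k = floor_vec (i + x) $ k"
      by (simp add: carry_vec_def frac_vec_def) linarith
  qed
  moreover have "i + frac_vec x - (\<chi> k. of_int (carry_vec x i $ k)) = 
      i + x - real_vec (floor_vec x + carry_vec x i)"
    by (simp add: vec_eq_iff frac_vec_def)
  ultimately show ?thesis
    by (simp add: sigma_rep_def carry_form_def frac_vec_eq)
qed

text \<open>The carried form is invariant under generating pairs, and each point reaches its carried
  form in one generating step; equivalent points are therefore joined by two steps through
  it.\<close>

lemma h_rel_iff:
  "(x, y) \<in> h_rel \<longleftrightarrow> x \<in> beta_space \<times> unit_cube \<and> y \<in> beta_space \<times> unit_cube \<and> carry_form x = carry_form y"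
proof -
  have gen: "carry_form x = carry_form y" if "(x, y) \<in> h_gen" for x y :: "(int^'n) set set \<times> (real^'n)"
    using that by (auto simp: h_gen_def psi_eq carry_form_shift)
  have inv: "carry_form x = carry_form y" if "(x, y) \<in> (h_gen \<union> h_gen\<inverse>)\<^sup>*" for x y :: "(int^'n) set set \<times> (real^'n)"
    using that by (induction rule: rtrancl_induct) (auto dest: gen)
  have step: "(x, carry_form x) \<in> h_gen" if "x \<in> beta_space \<times> unit_cube" for x :: "(int^'n) set set \<times> (real^'n)"
  proof -
    from that obtain p i where x: "x = (p, i)" "p \<in> beta_space" "i \<in> unit_cube"
      by blast
    \<comment> \<open>The step uses the largest admissible set \<open>A\<close>, that of all
      coordinates equal to 1.\<close>
    have "carry_form x = (hN (indic_vec {j. i $ j = 1}) p, psi {j. i $ j = 1} i)"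
      by (simp add: x carry_form_def frac_vec_eq floor_vec_unit_cube psi_eq)
    then show ?thesis
      unfolding h_gen_def using x by blast
  qed
  have conv: "(x, y) \<in> (h_gen \<union> h_gen\<inverse>)\<^sup>*"
    if "x \<in> beta_space \<times> unit_cube" "y \<in> beta_space \<times> unit_cube" "carry_form x = carry_form y"
    for x y :: "(int^'n) set set \<times> (real^'n)"
  proof -
    have "(x, carry_form x) \<in> h_gen \<union> h_gen\<inverse>" "(carry_form x, y) \<in> h_gen \<union> h_gen\<inverse>"
      using step[OF that(1)] step[OF that(2)] that(3) by simp_all
    then show ?thesis
      by (rule converse_rtrancl_into_rtrancl[OF _ r_into_rtrancl])
  qed
  show ?thesis
    unfolding h_rel_def using inv[of x y] conv[of x y] by blast
qed

lemma topspace_BI [simp]: "topspace BI_topology = beta_space \<times> unit_cube"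
  by (simp add: BI_topology_def)

lemma equiv_h_rel: "equiv (topspace BI_topology) h_rel"
proof (rule equivI)
  show "h_rel \<subseteq> topspace BI_topology \<times> topspace BI_topology"
    by (clarsimp simp: h_rel_iff)
  show "refl_on (topspace BI_topology) h_rel" "sym h_rel" "trans h_rel"
    by (simp_all add: refl_on_def sym_def trans_def h_rel_iff)
qed

lemma quotient_map_h_class: "quotient_map BI_topology K_topology h_class"
  using quotient_map_quotient_topology[OF equiv_h_rel]
  by (simp add: K_topology_def h_class_def[abs_def])

lemma topspace_K: "topspace K_topology = h_class ` (beta_space \<times> unit_cube)"
  using quotient_imp_surjective_map[OF quotient_map_h_class] by (metis topspace_BI)

lemma h_class_eq_iff:
  assumes "x \<in> beta_space \<times> unit_cube" "y \<in> beta_space \<times> unit_cube"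
  shows "h_class x = h_class y \<longleftrightarrow> carry_form x = carry_form y"
  using assms eq_equiv_class_iff[OF equiv_h_rel] by (auto simp: h_class_def h_rel_iff)

text \<open>The representative picked by \<open>SOME\<close> has the same carried form as
  \<open>(p, i)\<close>, and by \<open>carry_form_add\<close> the result depends on nothing
  else.\<close>

lemma K_sigma_h_class:
  fixes x i :: "real^'n"
  assumes "p \<in> beta_space" "i \<in> unit_cube"
  shows "K_sigma x (h_class (p, i)) = h_class (carry_form (p, i + x))"
proof -
  define r where "r = (SOME rp. rp \<in> h_class (p, i))"
  have "(p, i) \<in> h_class (p, i)"
    using assms by (simp add: h_class_def h_rel_iff)
  then have "r \<in> h_class (p, i)"
    unfolding r_def by (rule someI)
  then obtain q j where r: "r = (q, j)" "q \<in> beta_space" "j \<in> unit_cube" and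
    eq: "carry_form (q, j) = carry_form (p, i)"
    by (cases r) (auto simp: h_class_def h_rel_iff)
  have "carry_form (q, j + x) = carry_form (p, i + x)"
    using eq carry_form_add[of "(q, j)" x] carry_form_add[of "(p, i)" x] by simp
  then show ?thesis
    by (simp add: K_sigma_def r_def[symmetric] r(1) sigma_rep_eq r(3))
qed

section \<open>The ambit \<open>K\<close>\<close>

lemma unit_cube_eq_cbox: "unit_cube = cbox 0 (1 :: real^'n)"
  by (simp add: set_eq_iff unit_cube_def mem_box_cart)

text \<open>Integer translations leave the cube, so they are treated as maps of the product with all
  of \<open>real^'n\<close>, in which the product with the cube is a closed subspace.\<close>

lemma BI_topology_eq_subtopology:
  "BI_topology = subtopology (prod_topology beta_topology euclidean) (beta_space \<times> unit_cube)"
  by (simp add: BI_topology_def prod_topology_subtopology(2))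

lemma closedin_beta_Times_unit_cube:
  "closedin (prod_topology beta_topology euclidean)
    (beta_space \<times> unit_cube :: ((int^'n) set set \<times> (real^'n)) set)"
  using closed_cbox[of 0 "1 :: real^'n"] closedin_topspace[of "beta_topology :: (int^'n) set set topology"]
  by (simp add: closedin_prod_Times_iff unit_cube_eq_cbox)

lemma compact_space_BI: "compact_space BI_topology"
  by (simp add: BI_topology_def compact_space_prod_topology compact_space_beta compact_space_subtopology
      unit_cube_eq_cbox)

lemma Hausdorff_space_BI: "Hausdorff_space BI_topology"
  by (simp add: BI_topology_def Hausdorff_space_prod_topology Hausdorff_space_beta Hausdorff_space_subtopology)

lemma normal_space_BI: "normal_space BI_topology"
  using compact_space_BI Hausdorff_space_BI compact_Hausdorff_or_regular_imp_normal_space by blast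

lemma continuous_map_translate:
  "continuous_map (prod_topology beta_topology euclidean) (prod_topology beta_topology euclidean)
    (\<lambda>x. (hN N (fst x), snd x - real_vec N))"
proof (intro continuous_map_pairedI)
  show "continuous_map (prod_topology beta_topology euclidean) beta_topology (\<lambda>x. hN N (fst x))"
    using continuous_map_compose[OF continuous_map_fst continuous_map_hN] by (simp add: comp_def)
  have "continuous_map (prod_topology beta_topology euclidean) euclidean (snd :: _ \<Rightarrow> real^'a)"
    by (rule continuous_map_snd)
  then show "continuous_map (prod_topology beta_topology euclidean) euclidean (\<lambda>x. snd x - real_vec N)"
    by (intro continuous_intros) auto
qed

text \<open>Equal carried forms differ only in the integer vectors that were absorbed, so undoing
  one absorption exhibits each point as a translate of the other.\<close>

lemma carry_form_eqD:
  assumes "carry_form x = carry_form y"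
  defines "N \<equiv> floor_vec (snd x) - floor_vec (snd y)"
  shows "y = (hN N (fst x), snd x - real_vec N)"
proof (cases x; cases y)
  fix p i q j assume xy: "x = (p, i)" "y = (q, j)"
  with assms have eq: "hN (floor_vec i) p = hN (floor_vec j) q" "frac_vec i = frac_vec j"
    by (simp_all add: carry_form_def)
  have "q = hN (- floor_vec j) (hN (floor_vec j) q)"
    unfolding hN_add by simp
  also have "\<dots> = hN N p"
    unfolding eq(1)[symmetric] hN_add by (simp add: N_def xy)
  finally show ?thesis
    using eq(2) by (simp add: xy N_def frac_vec_eq vec_eq_iff algebra_simps)
qed

text \<open>The saturation of a closed set is a finite union of its translates.\<close>

lemma closed_map_h_class: "closed_map BI_topology K_topology h_class"
  unfolding closed_map_def
proof (intro allI impI)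
  fix C :: "((int^'n) set set \<times> (real^'n)) set"
  assume C: "closedin BI_topology C"
  define \<tau> where "\<tau> N x = (hN N (fst x), snd x - real_vec N)" for N :: "int^'n" and x
  \<comment> \<open>The floor of a cube point is an indicator vector, so only differences of two
    indicators can relate points of the cube.\<close>
  define I :: "(int^'n) set" where "I = (\<lambda>(A, B). indic_vec A - indic_vec B) ` UNIV"
  \<comment> \<open>Closedness is needed in the larger product because the translations
    \<open>\<tau> N\<close> take values there.\<close>
  have CP: "closedin (prod_topology beta_topology euclidean) C"
    using C closedin_beta_Times_unit_cube
    by (metis BI_topology_eq_subtopology closedin_trans_full)
  have Csub: "C \<subseteq> beta_space \<times> unit_cube"
    using closedin_subset[OF C] by simp
  have "{x \<in> topspace BI_topology. h_class x \<in> h_class ` C} =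
      (\<Union>N\<in>I. {x \<in> topspace BI_topology. \<tau> N x \<in> C})"
  proof (intro set_eqI iffI)
    fix x assume "x \<in> {x \<in> topspace BI_topology. h_class x \<in> h_class ` C}"
    then obtain y where xy: "x \<in> beta_space \<times> unit_cube" "y \<in> C" "h_class x = h_class y" by auto
    then have "carry_form x = carry_form y"
      using h_class_eq_iff Csub by blast
    then have "\<tau> (floor_vec (snd x) - floor_vec (snd y)) x = y"
      using carry_form_eqD by (metis \<tau>_def)
    moreover have "floor_vec (snd x) - floor_vec (snd y) \<in> I"
    proof -
      have "snd x \<in> unit_cube" "snd y \<in> unit_cube"
        using xy Csub by auto
      then show ?thesis
        unfolding I_def
        by (intro image_eqI[of _ _ "({j. snd x $ j = 1}, {j. snd y $ j = 1})"]) (simp_all add: floor_vec_unit_cube)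
    qed
    ultimately show "x \<in> (\<Union>N\<in>I. {x \<in> topspace BI_topology. \<tau> N x \<in> C})"
      using xy by (intro UN_I) auto
  next
    fix x assume "x \<in> (\<Union>N\<in>I. {x \<in> topspace BI_topology. \<tau> N x \<in> C})"
    then obtain N where N: "x \<in> beta_space \<times> unit_cube" "\<tau> N x \<in> C" by auto
    have "carry_form (\<tau> N x) = carry_form x"
      by (simp add: \<tau>_def carry_form_shift)
    then have "h_class x = h_class (\<tau> N x)"
      using N Csub h_class_eq_iff[of x "\<tau> N x"] by auto
    then show "x \<in> {x \<in> topspace BI_topology. h_class x \<in> h_class ` C}"
      using N by simp
  qed
  moreover have "closedin BI_topology {x \<in> topspace BI_topology. \<tau> N x \<in> C}" for N
  proof (rule closedin_continuous_map_preimage[OF _ CP])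
    show "continuous_map BI_topology (prod_topology beta_topology euclidean) (\<tau> N)"
      unfolding \<tau>_def BI_topology_eq_subtopology
      by (rule continuous_map_from_subtopology[OF continuous_map_translate])
  qed
  moreover have "finite I"
    unfolding I_def by simp
  ultimately have "closedin BI_topology {x \<in> topspace BI_topology. h_class x \<in> h_class ` C}"
    by (metis (no_types, lifting) closedin_Union finite_imageI imageE)
  moreover have "h_class ` C \<subseteq> topspace K_topology"
    using Csub unfolding topspace_K by blast
  ultimately show "closedin K_topology (h_class ` C)"
    using quotient_map_h_class unfolding quotient_map_closedin by blast
qed

section \<open>Compactness and separation of \<open>K\<close>\<close>

lemma continuous_map_h_class: "continuous_map BI_topology K_topology h_class"
  by (rule quotient_imp_continuous_map[OF quotient_map_h_class])

lemma compact_space_K: "compact_space K_topology"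
proof -
  have "compactin K_topology (h_class ` topspace BI_topology)"
    using compact_space_BI continuous_map_h_class unfolding compact_space_def by (rule image_compactin)
  then show ?thesis
    by (simp add: compact_space_def topspace_K)
qed

text \<open>The closed continuous map \<open>h_class\<close> transports normality from the compact
  Hausdorff product; points of \<open>K\<close> are closed as images of points.\<close>

lemma Hausdorff_space_K: "Hausdorff_space (K_topology :: ((int^'n) set set \<times> (real^'n)) set topology)"
proof (rule Hausdorff_normal_space_closed_continuous_map_image
    [OF normal_space_BI closed_map_h_class continuous_map_h_class])
  show surj: "h_class ` topspace BI_topology = topspace (K_topology :: ((int^'n) set set \<times> (real^'n)) set topology)"
    by (simp add: topspace_K)
  show "t1_space (K_topology :: ((int^'n) set set \<times> (real^'n)) set topology)"
    unfolding t1_space_closedin_singleton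
  proof
    fix c :: "((int^'n) set set \<times> (real^'n)) set" assume "c \<in> topspace K_topology"
    then obtain x where x: "x \<in> topspace BI_topology" "c = h_class x"
      using surj by blast
    have "closedin BI_topology {x}"
      by (rule closedin_Hausdorff_singleton[OF Hausdorff_space_BI x(1)])
    then show "closedin K_topology {c}"
      using closed_map_h_class x(2) by (metis closed_map_def image_empty image_insert)
  qed
qed

section \<open>Joint continuity of the action\<close>

lemma finite_int_vec_box:
  fixes a b :: "int^'n"
  shows "finite {N. \<forall>k. a $ k \<le> N $ k \<and> N $ k \<le> b $ k}"
proof (rule finite_subset)
  show "{N. \<forall>k. a $ k \<le> N $ k \<and> N $ k \<le> b $ k} \<subseteq> vec_lambda ` (PiE UNIV (\<lambda>k. {a $ k..b $ k}))"
  proof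
    fix N assume "N \<in> {N. \<forall>k. a $ k \<le> N $ k \<and> N $ k \<le> b $ k}"
    then show "N \<in> vec_lambda ` (PiE UNIV (\<lambda>k. {a $ k..b $ k}))"
      by (intro image_eqI[of _ _ "vec_nth N"]) (auto simp: vec_nth_inverse)
  qed
  show "finite (vec_lambda ` (PiE UNIV (\<lambda>k. {a $ k..b $ k})) :: (int^'n) set)"
    by (intro finite_imageI finite_PiE) auto
qed

lemma h_class_carry_form:
  assumes "x \<in> beta_space \<times> unit_cube"
  shows "h_class (carry_form x) = h_class x"
proof -
  obtain p i where x: "x = (p, i)" "p \<in> beta_space"
    using assms by (rule SigmaE)
  have "carry_form x \<in> beta_space \<times> unit_cube"
    unfolding x(1) by (rule carry_form_in[OF x(2)])
  then show ?thesis
    by (rule iffD2[OF h_class_eq_iff[OF _ assms] carry_form_idem])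
qed

text \<open>Paste over the locally finite cover of \<open>\<real>\<^sup>n\<close> by the unit cubes \<open>N + \<I>\<^sup>n\<close>.\<close>

lemma continuous_map_h_class_carry_form:
  "continuous_map (prod_topology beta_topology euclidean) (K_topology :: ((int^'n) set set \<times> (real^'n)) set topology)
    (\<lambda>x. h_class (carry_form x))"
proof -
  let ?P = "prod_topology beta_topology euclidean :: ((int^'n) set set \<times> (real^'n)) topology"
  define \<tau> where "\<tau> N x = (hN N (fst x), snd x - real_vec N)" for N :: "int^'n" and x
  \<comment> \<open>This is the part of the product lying over the cube
    \<open>N + \<I>\<^sup>n\<close>, written here as a preimage to make it visibly closed.\<close>
  define T where "T N = {x \<in> topspace ?P. \<tau> N x \<in> beta_space \<times> unit_cube}" for N
  have \<tau>: "continuous_map ?P ?P (\<tau> N)" for N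
    unfolding \<tau>_def by (rule continuous_map_translate)
  have T: "closedin ?P (T N)" for N
    unfolding T_def by (rule closedin_continuous_map_preimage[OF \<tau> closedin_beta_Times_unit_cube])
  \<comment> \<open>On \<open>T N\<close> the map agrees with \<open>h_class\<close> after the
    translation \<open>\<tau> N\<close>, which is continuous into the cube; the floor, discontinuous
    by itself, disappears.\<close>
  have cont: "continuous_map (subtopology ?P (T N)) K_topology (\<lambda>x. h_class (carry_form x))" for N
  proof (rule continuous_map_eq)
    have "continuous_map (subtopology ?P (T N)) BI_topology (\<tau> N)"
      unfolding BI_topology_eq_subtopology
      by (intro continuous_map_into_subtopology continuous_map_from_subtopology \<tau>) (auto simp: T_def)
    then show "continuous_map (subtopology ?P (T N)) K_topology (h_class \<circ> \<tau> N)"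
      using continuous_map_h_class by (rule continuous_map_compose)
    fix x assume "x \<in> topspace (subtopology ?P (T N))"
    then have "h_class (carry_form (\<tau> N x)) = h_class (\<tau> N x)"
      by (intro h_class_carry_form) (simp add: T_def)
    then show "(h_class \<circ> \<tau> N) x = h_class (carry_form x)"
      by (simp add: \<tau>_def carry_form_shift)
  qed
  have cover: "x \<in> T (floor_vec (snd x))" if "x \<in> topspace ?P" for x
    using that by (auto simp: T_def \<tau>_def simp flip: frac_vec_eq)
  have fin: "\<exists>V. openin ?P V \<and> x \<in> V \<and> finite {N \<in> UNIV. T N \<inter> V \<noteq> {}}"
    if x: "x \<in> topspace ?P" for x
  proof -
    define V where "V = (beta_space \<times> ball (snd x) 1 :: ((int^'n) set set \<times> (real^'n)) set)"
    have "openin ?P V"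
      using openin_topspace[of "beta_topology :: (int^'n) set set topology"]
      by (simp add: V_def openin_prod_Times_iff)
    moreover have "x \<in> V"
      using x by (auto simp: V_def)
    \<comment> \<open>A point \<open>y\<close> of the ball is within 1 of \<open>snd x\<close> in
      each coordinate, and \<open>N\<close> lies between \<open>y - 1\<close> and \<open>y\<close>;
      rounding leaves a margin of 2 around the floor.\<close>
    moreover have "{N \<in> UNIV. T N \<inter> V \<noteq> {}} \<subseteq>
        {N. \<forall>k. (\<chi> k. \<lfloor>snd x $ k\<rfloor> - 2) $ k \<le> N $ k \<and> N $ k \<le> (\<chi> k. \<lfloor>snd x $ k\<rfloor> + 2) $ k}"
    proof
      fix N assume "N \<in> {N \<in> UNIV. T N \<inter> V \<noteq> {}}"
      then obtain p y where y: "y \<in> ball (snd x) 1" "y - real_vec N \<in> unit_cube"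
        by (auto simp: T_def V_def \<tau>_def)
      have "\<lfloor>snd x $ k\<rfloor> - 2 \<le> N $ k \<and> N $ k \<le> \<lfloor>snd x $ k\<rfloor> + 2" for k
      proof -
        have "\<bar>snd x $ k - y $ k\<bar> < 1"
          using component_le_norm_cart[of "snd x - y" k] y(1) by (simp add: dist_norm)
        moreover have "0 \<le> y $ k - of_int (N $ k)" "y $ k - of_int (N $ k) \<le> 1"
          using y(2) by (simp_all add: unit_cube_def)
        ultimately show ?thesis by linarith
      qed
      then show "N \<in> {N. \<forall>k. (\<chi> k. \<lfloor>snd x $ k\<rfloor> - 2) $ k \<le> N $ k \<and>
          N $ k \<le> (\<chi> k. \<lfloor>snd x $ k\<rfloor> + 2) $ k}"
        by simp
    qed
    ultimately show ?thesis
      using finite_subset[OF _ finite_int_vec_box] by blast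
  qed
  show ?thesis
    by (rule pasting_lemma_locally_finite[of ?P UNIV T _ "\<lambda>_ x. h_class (carry_form x)", OF fin T cont])
      (use cover in auto)
qed

text \<open>Local compactness of the group keeps \<open>h_class\<close> a quotient map after taking
  the product with the group. Upstairs the action is an addition followed by the continuous map of
  \<open>continuous_map_h_class_carry_form\<close>.\<close>

lemma continuous_map_K_sigma:
  "continuous_map (prod_topology euclidean K_topology) K_topology (\<lambda>(g :: real^'n, c). K_sigma g c)"
proof (rule continuous_compose_quotient_map)
  let ?G = "euclidean :: (real^'n) topology"
  show "quotient_map (prod_topology ?G BI_topology) (prod_topology ?G K_topology) (\<lambda>(g, x). (g, h_class x))"
    by (rule quotient_map_prod_right[OF locally_compact_space_euclidean _ quotient_map_h_class]) simp
  show "continuous_map (prod_topology ?G BI_topology) K_topology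
      ((\<lambda>(g, c). K_sigma g c) \<circ> (\<lambda>(g, x). (g, h_class x)))"
  proof (rule continuous_map_eq)
    have "continuous_map (prod_topology ?G BI_topology) beta_topology (\<lambda>z. fst (snd z))"
      unfolding BI_topology_def
      using continuous_map_compose[OF continuous_map_snd continuous_map_fst] by (simp add: comp_def)
    moreover have "continuous_map (prod_topology ?G BI_topology) ?G (\<lambda>z. snd (snd z))"
      using continuous_map_compose[OF continuous_map_snd continuous_map_into_fulltopology[OF continuous_map_snd]]
      unfolding BI_topology_def by (simp add: comp_def)
    then have "continuous_map (prod_topology ?G BI_topology) ?G (\<lambda>z. snd (snd z) + fst z)"
      by (intro continuous_map_add continuous_map_fst)
    ultimately have "continuous_map (prod_topology ?G BI_topology) (prod_topology beta_topology ?G)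
        (\<lambda>z. (fst (snd z), snd (snd z) + fst z))"
      by (rule continuous_map_pairedI)
    then show "continuous_map (prod_topology ?G BI_topology) K_topology
        (\<lambda>z. h_class (carry_form (fst (snd z), snd (snd z) + fst z)))"
      using continuous_map_compose[OF _ continuous_map_h_class_carry_form] by (fastforce simp: comp_def)
  qed (auto simp: K_sigma_h_class)
qed

section \<open>Action laws and density of the base orbit\<close>

lemma K_sigma_zero:
  assumes "c \<in> topspace K_topology"
  shows "K_sigma 0 c = c"
proof -
  obtain p i where c: "c = h_class (p, i)" "p \<in> beta_space" "i \<in> unit_cube"
    using assms by (auto simp: topspace_K)
  then show ?thesis
    using K_sigma_h_class[of p i 0] h_class_carry_form[of "(p, i)"] by simp
qed

lemma K_sigma_add:
  fixes g h :: "real^'n"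
  assumes "c \<in> topspace K_topology"
  shows "K_sigma (g + h) c = K_sigma g (K_sigma h c)"
proof -
  obtain p i where c: "c = h_class (p, i)" "p \<in> beta_space" "i \<in> unit_cube"
    using assms by (auto simp: topspace_K)
  obtain q j where qj: "carry_form (p, i + h) = (q, j)" by fastforce
  then have "q \<in> beta_space" "j \<in> unit_cube"
    using carry_form_in[OF c(2), of "i + h"] by auto
  then have "K_sigma g (K_sigma h c) = h_class (carry_form (q, j + g))"
    by (simp add: c K_sigma_h_class qj)
  also have "carry_form (q, j + g) = carry_form (p, i + (g + h))"
    using carry_form_add[of "(p, i + h)" g] by (simp add: qj add.assoc add.commute[of g])
  finally show ?thesis
    by (simp add: c K_sigma_h_class)
qed

lemma zero_in_unit_cube [simp]: "0 \<in> unit_cube"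
  by (simp add: unit_cube_def)

text \<open>The orbit of the base point thus contains every class with a principal first component;
  these classes are dense because principal ultrafilters are.\<close>

lemma K_sigma_K_base:
  assumes "i \<in> unit_cube"
  shows "K_sigma (real_vec z + i) K_base = h_class (beta_point z, i)"
proof -
  have "carry_form (beta_point 0, real_vec z + i) = carry_form (beta_point z, i)"
    using carry_form_shift[of z "beta_point 0" "real_vec z + i"] by (simp add: hN_beta_point)
  then show ?thesis
    using assms by (simp add: K_base_def K_sigma_h_class h_class_carry_form)
qed

lemma K_base_orbit_dense:
  "K_topology closure_of range (\<lambda>g. K_sigma g K_base) = (topspace K_topology :: ((int^'n) set set \<times> (real^'n)) set set)"
proof (rule antisym[OF closure_of_subset_topspace])
  let ?S = "range beta_point \<times> unit_cube :: ((int^'n) set set \<times> (real^'n)) set"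
  have "BI_topology closure_of ?S = beta_space \<times> unit_cube"
    using closure_of_topspace[of "subtopology euclidean (unit_cube :: (real^'n) set)"]
    by (simp add: BI_topology_def closure_of_Times beta_point_dense)
  then have "topspace K_topology \<subseteq> K_topology closure_of (h_class ` ?S)"
    using continuous_map_image_closure_subset[OF continuous_map_h_class, of ?S] by (simp add: topspace_K)
  also have "\<dots> \<subseteq> K_topology closure_of range (\<lambda>g. K_sigma g K_base)"
    by (rule closure_of_mono) (auto simp flip: K_sigma_K_base)
  finally show "topspace K_topology \<subseteq> K_topology closure_of range (\<lambda>g. K_sigma g (K_base :: ((int^'n) set set \<times> (real^'n)) set))" .
qed

lemma ambit_K: "ambit (K_topology :: ((int^'n) set set \<times> (real^'n)) set topology) K_sigma K_base"
  unfolding ambit_def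
proof (intro conjI allI ballI impI)
  show "K_base \<in> topspace K_topology"
    unfolding K_base_def topspace_K by (intro imageI) simp
qed (simp_all add: compact_space_K Hausdorff_space_K continuous_map_K_sigma K_base_orbit_dense
    K_sigma_zero K_sigma_add)

section \<open>Homomorphisms onto an arbitrary ambit\<close>

lemma ambit_hom_surj:
  assumes X: "ambit X \<pi> x0" and Y: "ambit Y \<rho> y0" and f: "ambit_hom X \<pi> x0 Y \<rho> y0 f"
  shows "f ` topspace X = topspace Y"
proof
  have cont: "continuous_map X Y f" and x0: "x0 \<in> topspace X"
    using X f by (simp_all add: ambit_def ambit_hom_def)
  show "f ` topspace X \<subseteq> topspace Y"
    using cont by (rule continuous_map_image_subset_topspace)
  have "closedin Y (f ` topspace X)"
    using image_compactin[OF _ cont] X Y by (intro compactin_imp_closedin) (auto simp: ambit_def compact_space_def)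
  moreover have "range (\<lambda>g. \<rho> g y0) \<subseteq> f ` topspace X"
  proof clarify
    fix g
    have "\<pi> g x0 \<in> topspace X"
      using X x0 continuous_map_image_subset_topspace[of "prod_topology euclidean X" X "\<lambda>(g, x). \<pi> g x"]
      by (auto simp: ambit_def)
    moreover have "f (\<pi> g x0) = \<rho> g y0"
      using f x0 by (simp add: ambit_hom_def)
    ultimately show "\<rho> g y0 \<in> f ` topspace X" by force
  qed
  ultimately have "Y closure_of range (\<lambda>g. \<rho> g y0) \<subseteq> f ` topspace X"
    by (rule closure_of_minimal[rotated])
  then show "topspace Y \<subseteq> f ` topspace X"
    using Y by (simp add: ambit_def)
qed

lemma ambit_hom_K_exists:
  fixes \<rho> :: "real^'n \<Rightarrow> 'y \<Rightarrow> 'y"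
  assumes Y: "ambit Y \<rho> y0"
  obtains f where "ambit_hom K_topology K_sigma K_base Y \<rho> y0 f"
proof -
  have cont: "continuous_map (prod_topology euclidean Y) Y (\<lambda>(g, x). \<rho> g x)"
    and zero: "\<And>y. y \<in> topspace Y \<Longrightarrow> \<rho> 0 y = y"
    and add: "\<And>g h y. y \<in> topspace Y \<Longrightarrow> \<rho> (g + h) y = \<rho> g (\<rho> h y)"
    and Y': "compact_space Y" "Hausdorff_space Y" "y0 \<in> topspace Y"
    using Y by (auto simp: ambit_def)
  have mem: "\<rho> g y \<in> topspace Y" if "y \<in> topspace Y" for g y
    using continuous_map_image_subset_topspace[OF cont] that by auto
  have cont1: "continuous_map Y Y (\<rho> g)" for g
  proof -
    have "continuous_map Y (prod_topology euclidean Y) (\<lambda>y. (g, y))"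
      by (intro continuous_map_pairedI) auto
    from continuous_map_compose[OF this cont] show ?thesis by (simp add: comp_def)
  qed
  obtain F :: "(int^'n) set set \<Rightarrow> 'y" where F: "continuous_map beta_topology Y F"
    and F_point: "\<And>z. F (beta_point z) = \<rho> (real_vec z) y0"
    using beta_extension_exists[OF Y'(1,2), of "\<lambda>z. \<rho> (real_vec z) y0"] mem Y'(3) by blast
  have F_mem: "F p \<in> topspace Y" if "p \<in> beta_space" for p
    using continuous_map_image_subset_topspace[OF F] that by auto
  \<comment> \<open>Both sides are continuous in \<open>p\<close> and agree at principal
    ultrafilters by the action law, so they agree on the closure as \<open>Y\<close> is
    Hausdorff.\<close>
  have F_hN: "F (hN N p) = \<rho> (real_vec N) (F p)" if "p \<in> beta_space" for N p
  proof (rule forall_in_closure_of_eq[of p beta_topology "range beta_point" Y "\<lambda>p. F (hN N p)"])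
    show "continuous_map beta_topology Y (\<lambda>p. F (hN N p))"
      using continuous_map_compose[OF continuous_map_hN F] by (simp add: comp_def)
    show "continuous_map beta_topology Y (\<lambda>p. \<rho> (real_vec N) (F p))"
      using continuous_map_compose[OF F cont1] by (simp add: comp_def)
    show "F (hN N q) = \<rho> (real_vec N) (F q)" if "q \<in> range beta_point" for q
      using that add[OF Y'(3), of "real_vec N"] by (auto simp: hN_beta_point F_point real_vec_add add.commute)
  qed (use that Y' in \<open>simp_all add: beta_point_dense\<close>)
  \<comment> \<open>\<open>H\<close> evaluates the point \<open>p + i\<close> in \<open>Y\<close>
    for arbitrary real \<open>i\<close>; by \<open>F_hN\<close> carrying does not change its value,
    which is what lets it descend to \<open>K\<close>.\<close>
  define H where "H x = \<rho> (snd x) (F (fst x))" for x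
  have H_carry: "H (carry_form x) = H x" if "fst x \<in> beta_space" for x
  proof -
    have "H (carry_form x) = \<rho> (frac_vec (snd x)) (\<rho> (real_vec (floor_vec (snd x))) (F (fst x)))"
      by (simp add: H_def carry_form_def F_hN that)
    also have "\<dots> = \<rho> (frac_vec (snd x) + real_vec (floor_vec (snd x))) (F (fst x))"
      using add F_mem that by simp
    finally show ?thesis
      by (simp add: H_def frac_vec_eq)
  qed
  have "continuous_map BI_topology Y H"
  proof -
    have "continuous_map BI_topology (prod_topology euclidean Y) (\<lambda>x. (snd x, F (fst x)))"
    proof (rule continuous_map_pairedI)
      show "continuous_map BI_topology euclidean (\<lambda>x. snd x)"
        unfolding BI_topology_def by (rule continuous_map_into_fulltopology[OF continuous_map_snd])
      show "continuous_map BI_topology Y (\<lambda>x. F (fst x))"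
        unfolding BI_topology_def
        using continuous_map_compose[OF continuous_map_fst F] by (simp add: comp_def)
    qed
    from continuous_map_compose[OF this cont] show ?thesis
      by (simp add: comp_def H_def[abs_def])
  qed
  moreover have "H x = H y" if "x \<in> topspace BI_topology" "y \<in> topspace BI_topology" "h_class x = h_class y" for x y
    using that H_carry[of x] H_carry[of y] h_class_eq_iff[of x y] by auto
  ultimately obtain f where f: "continuous_map K_topology Y f"
    and fH: "\<And>x. x \<in> topspace BI_topology \<Longrightarrow> f (h_class x) = H x"
    using quotient_map_lift_exists[OF quotient_map_h_class] by metis
  have "f (K_sigma g c) = \<rho> g (f c)" if c: "c \<in> topspace K_topology" for g c
  proof -
    obtain p i where pi: "c = h_class (p, i)" "p \<in> beta_space" "i \<in> unit_cube"
      using c by (auto simp: topspace_K)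
    have "f (K_sigma g c) = H (carry_form (p, i + g))"
      using carry_form_in[OF pi(2), of "i + g"] by (simp add: pi K_sigma_h_class fH)
    \<comment> \<open>Commutativity of the group puts \<open>g\<close> on the left, ready for the
      action law.\<close>
    also have "\<dots> = \<rho> (g + i) (F p)"
      using H_carry pi by (simp add: H_def add.commute)
    also have "\<dots> = \<rho> g (f c)"
      using add F_mem pi by (simp add: fH H_def)
    finally show ?thesis .
  qed
  moreover have "f K_base = y0"
    using zero Y'(3) by (simp add: K_base_def fH H_def F_point) (simp add: real_vec_def zero_vec_def[symmetric])
  ultimately show thesis
    using f that unfolding ambit_hom_def by blast
qed

text \<open>This is the defining property of a universal ambit, for targets with points in an
  arbitrary type \<open>'y\<close>; uniqueness of the universal ambit up to isomorphism turns it
  into the isomorphism claimed.\<close>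

theorem theorem1:
  shows "ambit (K_topology :: ((int^'n) set set \<times> (real^'n)) set topology) K_sigma K_base \<and>
         (\<forall>(Y :: 'y topology) (\<rho> :: real^'n \<Rightarrow> 'y \<Rightarrow> 'y) y0. ambit Y \<rho> y0 \<longrightarrow>
            (\<exists>f. ambit_hom K_topology K_sigma K_base Y \<rho> y0 f \<and> f ` topspace K_topology = topspace Y))"
proof (intro conjI allI impI)
  show "ambit (K_topology :: ((int^'n) set set \<times> (real^'n)) set topology) K_sigma K_base"
    by (rule ambit_K)
  fix Y :: "'y topology" and \<rho> :: "real^'n \<Rightarrow> 'y \<Rightarrow> 'y" and y0
  assume Y: "ambit Y \<rho> y0"
  then obtain f where f: "ambit_hom K_topology K_sigma K_base Y \<rho> y0 f"
    by (rule ambit_hom_K_exists)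
  then show "\<exists>f. ambit_hom K_topology K_sigma K_base Y \<rho> y0 f \<and> f ` topspace K_topology = topspace Y"
    using ambit_hom_surj[OF ambit_K Y f] by blast
qed

end
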